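(* Let $m,n\ge 1$ be integers. Let $A$ (resp. $\overline{A}$) be the transfer matrix indexed by signatures (resp. cyclic signatures) of length $m$, and let $\sigma_{\mathtt c}=(\mathtt c,\mathtt c,\ldots,\mathtt c)$ be the (cyclic) signature of length $m$ which is covered everywhere. For a (cyclic) signature $\sigma$ let $\mathtt u(\sigma)$ denote the number of entries of $\sigma$ equal to $\mathtt u$. Then the domination polynomials $G_{m\times n}(z)$ of the $m\times n$ grid graph and $G_{\overline m\times n}(z)$ of the $m\times n$ cylinder graph satisfy $$G_{m\times n}(z)=\sum_{\sigma\,:\,\mathtt u(\sigma)=0}(A^n)_{\sigma,\sigma_{\mathtt c}},\qquad G_{\overline m\times n}(z)=\sum_{\sigma\,:\,\mathtt u(\sigma)=0}(\overline{A}^{\,n})_{\sigma,\sigma_{\mathtt c}},$$ where the first sum runs over all signatures $\sigma$ of length $m$ with $\mathtt u(\sigma)=0$ and the second over all cyclic signatures $\sigma$ of length $m$ with $\mathtt u(\sigma)=0$.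
   Context: Dominating set: a subset $S\subseteq V$ of the vertices of a graph $G=(V,E)$ such that every vertex of $V$ is in $S$ or has a neighbor in $S$. Domination polynomial of $G$: $D_G(z)=\sum_S z^{|S|}$, the sum over all dominating sets $S$ of $G$. Graphs: $P_k$ is the path graph on $k$ vertices, $C_k$ the cycle graph on $k$ vertices (vertices $\mathbb Z/k$, with distinct $i,j$ adjacent iff $j=i\pm1 \bmod k$, so $C_1$ and $C_2$ are a single vertex and a single edge). The $m\times n$ grid graph is the Cartesian product $P_m\square P_n$ and the $m\times n$ cylinder graph is $C_m\square P_n$. $G_{m\times n}(z)$ and $G_{\overline m\times n}(z)$ denote their respective domination polynomials. Signatures: the alphabet is $\{\mathtt u,\mathtt c,\mathtt o\}$ (uncovered, covered, occupied). A signature of length $m$ is a string $\sigma=(\sigma_1,\ldots,\sigma_m)$ over this alphabet containing neither of the substrings $(\mathtt u,\mathtt o)$ and $(\mathtt o,\mathtt u)$ in consecutive positions. A cyclic signature is a signature for which, in addition, $\{\sigma_1,\sigma_m\}\neq\{\mathtt u,\mathtt o\}$. Compatibility: a (cyclic) signature $\tau=(\tau_1,\ldots,\tau_m)$ is compatible with a (cyclic) signature $\sigma=(\sigma_1,\ldots,\sigma_m)$ if for all $i=1,\ldots,m$: (1) $\sigma_i=\mathtt u\Rightarrow\tau_i=\mathtt o$; (2) $\sigma_i=\mathtt o\Rightarrow\tau_i\in\{\mathtt c,\mathtt o\}$; (3) $\tau_i=\mathtt c\Rightarrow(\sigma_i=\mathtt o)$ or $(\tau_{i-1}=\mathtt o)$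 or $(\tau_{i+1}=\mathtt o)$. In (3) the indices $i\pm1$ are taken modulo $m$ for cyclic signatures, while in the non-cyclic case the conditions involving $\tau_0$ and $\tau_{m+1}$ are ignored (treated as false). Transfer matrix: let $\mathtt o(\tau)$ be the number of entries of $\tau$ equal to $\mathtt o$. $A=(A_{\tau,\sigma})$, with rows $\tau$ and columns $\sigma$ ranging over all signatures of length $m$, is defined by $A_{\tau,\sigma}=z^{\mathtt o(\tau)}$ if $\tau$ is compatible with $\sigma$, and $A_{\tau,\sigma}=0$ otherwise. $\overline A$ is defined in the same way with $\tau,\sigma$ ranging over all cyclic signatures of length $m$. Entries lie in $\mathbb Z[z]$. *)

theory Defs
  imports
    "Graph_Theory.Pair_Digraph"
    "Jordan_Normal_Form.Matrix"
    "HOL-Computational_Algebra.Polynomial"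
begin

text \<open>Finite simple graphs are rendered as symmetric loop-free digraphs without parallel arcs
  (locale \<^locale>\<open>pair_graph\<close>): an edge between \<open>u\<close> and \<open>v\<close> is the pair of
  arcs \<open>(u, v)\<close>, \<open>(v, u)\<close>.\<close>

definition dominating_set :: "'a pair_pre_digraph \<Rightarrow> 'a set \<Rightarrow> bool" where
  "dominating_set G S \<longleftrightarrow>
     S \<subseteq> pverts G \<and> (\<forall>v\<in>pverts G. v \<in> S \<or> (\<exists>w\<in>S. (v, w) \<in> parcs G))"

definition domination_poly :: "'a pair_pre_digraph \<Rightarrow> int poly" where
  "domination_poly G = (\<Sum>S | dominating_set G S. monom 1 (card S))"

definition path_graph :: "nat \<Rightarrow> nat pair_pre_digraph" where
  "path_graph k =
     \<lparr> pverts = {..<k},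
       parcs = {(i, j). i < k \<and> j < k \<and> (j = i + 1 \<or> i = j + 1)} \<rparr>"

definition cycle_graph :: "nat \<Rightarrow> nat pair_pre_digraph" where
  "cycle_graph k =
     \<lparr> pverts = {..<k},
       parcs = {(i, j). i < k \<and> j < k \<and> i \<noteq> j \<and>
                  (j = (i + 1) mod k \<or> j = (i + k - 1) mod k)} \<rparr>"

definition cartesian_product ::
  "'a pair_pre_digraph \<Rightarrow> 'b pair_pre_digraph \<Rightarrow> ('a \<times> 'b) pair_pre_digraph" where
  "cartesian_product G H =
     \<lparr> pverts = pverts G \<times> pverts H,
       parcs = {((a, b), (a', b')).
                  (a = a' \<and> a \<in> pverts G \<and> (b, b') \<in> parcs H) \<or>
                  (b = b' \<and> b \<in> pverts H \<and> (a, a') \<in> parcs G)} \<rparr>"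

definition grid_graph :: "nat \<Rightarrow> nat \<Rightarrow> (nat \<times> nat) pair_pre_digraph" where
  "grid_graph m n = cartesian_product (path_graph m) (path_graph n)"

definition cylinder_graph :: "nat \<Rightarrow> nat \<Rightarrow> (nat \<times> nat) pair_pre_digraph" where
  "cylinder_graph m n = cartesian_product (cycle_graph m) (path_graph n)"

lemma pair_graph_path_graph: "pair_graph (path_graph k)"
proof (unfold_locales)
  show "finite (parcs (path_graph k))"
    by (rule finite_subset[of _ "{..<k} \<times> {..<k}"]) (auto simp: path_graph_def)
qed (auto simp: path_graph_def symmetric_def sym_def)

lemma pair_graph_cycle_graph: "pair_graph (cycle_graph k)"
proof -
  have bwd: "i = (j + k - 1) mod k" if "i < k" "j = (i + 1) mod k" for i j :: nat
    using that by (cases "i + 1 = k") auto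
  have fwd: "i = (j + 1) mod k" if "i < k" "j = (i + k - 1) mod k" for i j :: nat
    using that by (cases i) auto
  show ?thesis
  proof (unfold_locales)
    show "finite (parcs (cycle_graph k))"
      by (rule finite_subset[of _ "{..<k} \<times> {..<k}"]) (auto simp: cycle_graph_def)
    show "symmetric (with_proj (cycle_graph k))"
      unfolding symmetric_def sym_def cycle_graph_def using bwd fwd by auto
  qed (auto simp: cycle_graph_def)
qed

lemma pair_graph_cartesian_product:
  assumes "pair_graph G" and "pair_graph H"
  shows "pair_graph (cartesian_product G H)"
proof -
  interpret G: pair_graph G by fact
  interpret H: pair_graph H by fact
  have arc_sym: "(y, x) \<in> parcs G" if "(x, y) \<in> parcs G" for x y
    using that G.pair_sym_arcs by (auto simp: symmetric_def dest: symD)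
  have arc_sym': "(y, x) \<in> parcs H" if "(x, y) \<in> parcs H" for x y
    using that H.pair_sym_arcs by (auto simp: symmetric_def dest: symD)
  show ?thesis
  proof (unfold_locales)
    show "finite (pverts (cartesian_product G H))"
      by (simp add: cartesian_product_def G.pair_finite_verts H.pair_finite_verts)
    then show "finite (parcs (cartesian_product G H))"
      using finite_subset[of "parcs (cartesian_product G H)"
          "pverts (cartesian_product G H) \<times> pverts (cartesian_product G H)"]
      by (auto simp: cartesian_product_def dest: G.wellformed' H.wellformed')
    show "symmetric (with_proj (cartesian_product G H))"
      by (auto simp: symmetric_def sym_def cartesian_product_def intro: arc_sym arc_sym')
    show "fst e \<noteq> snd e" if "e \<in> parcs (cartesian_product G H)" for e
      using that by (auto simp: cartesian_product_def dest: G.pair_no_loops H.pair_no_loops)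
  qed (auto simp: cartesian_product_def dest: G.wellformed' H.wellformed')
qed


datatype letter = Uncovered | Covered | Occupied

text \<open>Positions are numbered from \<open>0\<close> to \<open>m - 1\<close>.\<close>

definition is_signature :: "nat \<Rightarrow> letter list \<Rightarrow> bool" where
  "is_signature m \<sigma> \<longleftrightarrow> length \<sigma> = m \<and>
     (\<forall>i. i + 1 < m \<longrightarrow>
        (\<sigma> ! i, \<sigma> ! (i + 1)) \<notin> {(Uncovered, Occupied), (Occupied, Uncovered)})"

definition is_cyclic_signature :: "nat \<Rightarrow> letter list \<Rightarrow> bool" where
  "is_cyclic_signature m \<sigma> \<longleftrightarrow>
     is_signature m \<sigma> \<and> {\<sigma> ! 0, \<sigma> ! (m - 1)} \<noteq> {Uncovered, Occupied}"

definition compatible :: "nat \<Rightarrow> letter list \<Rightarrow> letter list \<Rightarrow> bool" where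
  "compatible m \<tau> \<sigma> \<longleftrightarrow> (\<forall>i<m.
     (\<sigma> ! i = Uncovered \<longrightarrow> \<tau> ! i = Occupied) \<and>
     (\<sigma> ! i = Occupied \<longrightarrow> \<tau> ! i \<in> {Covered, Occupied}) \<and>
     (\<tau> ! i = Covered \<longrightarrow>
        \<sigma> ! i = Occupied \<or>
        (0 < i \<and> \<tau> ! (i - 1) = Occupied) \<or>
        (i + 1 < m \<and> \<tau> ! (i + 1) = Occupied)))"

definition cyclic_compatible :: "nat \<Rightarrow> letter list \<Rightarrow> letter list \<Rightarrow> bool" where
  "cyclic_compatible m \<tau> \<sigma> \<longleftrightarrow> (\<forall>i<m.
     (\<sigma> ! i = Uncovered \<longrightarrow> \<tau> ! i = Occupied) \<and>
     (\<sigma> ! i = Occupied \<longrightarrow> \<tau> ! i \<in> {Covered, Occupied}) \<and>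
     (\<tau> ! i = Covered \<longrightarrow>
        \<sigma> ! i = Occupied \<or>
        \<tau> ! ((i + m - 1) mod m) = Occupied \<or>
        \<tau> ! ((i + 1) mod m) = Occupied))"

text \<open>The matrices of the library are indexed by numbers, so the signatures are enumerated by a
  list. The choice of the order is immaterial: entries are only accessed through
  \<open>entry_at\<close>, that is, by their labels.\<close>

definition signatures :: "nat \<Rightarrow> letter list list" where
  "signatures m = filter (is_signature m) (List.n_lists m [Uncovered, Covered, Occupied])"

definition cyclic_signatures :: "nat \<Rightarrow> letter list list" where
  "cyclic_signatures m =
     filter (is_cyclic_signature m) (List.n_lists m [Uncovered, Covered, Occupied])"

definition labelled_mat :: "'i list \<Rightarrow> ('i \<Rightarrow> 'i \<Rightarrow> 'a) \<Rightarrow> 'a mat" where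
  "labelled_mat xs f = mat (length xs) (length xs) (\<lambda>(i, j). f (xs ! i) (xs ! j))"

definition position :: "'i list \<Rightarrow> 'i \<Rightarrow> nat" where
  "position xs x = the_inv_into {..<length xs} ((!) xs) x"

definition entry_at :: "'i list \<Rightarrow> 'a mat \<Rightarrow> 'i \<Rightarrow> 'i \<Rightarrow> 'a" where
  "entry_at xs M x y = M $$ (position xs x, position xs y)"

definition transfer_matrix :: "nat \<Rightarrow> int poly mat" where
  "transfer_matrix m = labelled_mat (signatures m)
     (\<lambda>\<tau> \<sigma>. if compatible m \<tau> \<sigma> then monom 1 (count_list \<tau> Occupied) else 0)"

definition cyclic_transfer_matrix :: "nat \<Rightarrow> int poly mat" where
  "cyclic_transfer_matrix m = labelled_mat (cyclic_signatures m)
     (\<lambda>\<tau> \<sigma>. if cyclic_compatible m \<tau> \<sigma> then monom 1 (count_list \<tau> Occupied) else 0)"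

lemma letters_eq: "set [Uncovered, Covered, Occupied] = UNIV"
  using letter.exhaust by auto

lemma set_signatures: "set (signatures m) = {\<sigma>. is_signature m \<sigma>}"
  unfolding signatures_def set_filter set_n_lists letters_eq by (auto simp: is_signature_def)

lemma set_cyclic_signatures: "set (cyclic_signatures m) = {\<sigma>. is_cyclic_signature m \<sigma>}"
  unfolding cyclic_signatures_def set_filter set_n_lists letters_eq
  by (auto simp: is_cyclic_signature_def is_signature_def)

lemma distinct_signatures: "distinct (signatures m)"
  by (simp add: signatures_def distinct_n_lists)

lemma distinct_cyclic_signatures: "distinct (cyclic_signatures m)"
  by (simp add: cyclic_signatures_def distinct_n_lists)

lemma position_nth:
  assumes "distinct xs" and "i < length xs"
  shows "position xs (xs ! i) = i"
  unfolding position_def using assms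
  by (intro the_inv_into_f_f) (auto simp: inj_on_def nth_eq_iff_index_eq)

lemma entry_at_labelled_mat:
  assumes "distinct xs" and "x \<in> set xs" and "y \<in> set xs"
  shows "entry_at xs (labelled_mat xs f) x y = f x y"
  using assms by (auto simp: in_set_conv_nth entry_at_def labelled_mat_def position_nth)

end

theory Submission
  imports Defs
begin

text \<open>
  A vertex set \<open>S\<close> of the product of a column graph \<open>H\<close> with a path can be read one column at
  a time. After the first \<open>k\<close> columns have been read, all that matters for the future is, for
  each vertex of the last of them, whether it belongs to \<open>S\<close>, is dominated by \<open>S\<close> from within
  the first \<open>k\<close> columns, or is still undominated: a word over the three letters. An undominated
  vertex can be rescued only by its neighbour in the next column, so \<open>S\<close> is dominating iff
  every vertex that was uncovered after some column is followed by an occupied one, and no vertex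
  is uncovered at the end. Before any column has been read one may pretend that a fully covered
  column precedes the graph: it demands nothing of the first column and dominates nothing in it.

  The word after column \<open>k + 1\<close> is a function of the word after column \<open>k\<close> and of the set of
  vertices chosen in column \<open>k + 1\<close>. Conversely, a signature \<open>\<tau>\<close> reveals the chosen set, namely
  its occupied positions. So compatibility of \<open>\<tau>\<close> with \<open>\<sigma>\<close> says exactly that \<open>\<tau>\<close> arises
  from \<open>\<sigma>\<close> by choosing this set, and that this choice covers every uncovered position of
  \<open>\<sigma>\<close> (\<open>col_compatible_iff_next_signature\<close>). Appending a column is thus a bijection, which turns
  into the recursion \<open>restricted_poly_Suc\<close>: multiplication by the transfer matrix. By induction
  the entry \<open>(\<tau>, \<sigma>\<^sub>c)\<close> of its \<open>n\<close>-th power enumerates by size the sets that have dominated all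
  columns but possibly the last and that end in \<open>\<tau>\<close>; summing over the \<open>\<tau>\<close> with no uncovered
  position gives the domination polynomial (\<open>domination_poly_cartesian_path\<close>).

  Nothing here depends on the shape of \<open>H\<close>. The grid and the cylinder are the cases of a path
  and of a cycle, for which only the neighbourhoods have to be made explicit.
\<close>

section \<open>Powers of a labelled matrix\<close>

text \<open>Powers are defined by multiplication on the right, but a new column acts on the row index, that
  is, on the left.\<close>

lemma pow_mat_Suc_left:
  assumes "A \<in> carrier_mat k k"
  shows "A ^\<^sub>m Suc n = A * A ^\<^sub>m n"
proof (induction n)
  case 0
  then show ?case using assms by simp
next
  case (Suc n)
  have "A ^\<^sub>m Suc (Suc n) = (A * A ^\<^sub>m n) * A"
    using Suc by simp
  also have "\<dots> = A * (A ^\<^sub>m n * A)"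
    using assms by (intro assoc_mult_mat) auto
  finally show ?case by simp
qed

lemma labelled_mat_carrier: "labelled_mat xs f \<in> carrier_mat (length xs) (length xs)"
  by (simp add: labelled_mat_def)

lemma entry_at_pow_0:
  assumes "distinct xs" and "x \<in> set xs" and "y \<in> set xs"
  shows "entry_at xs (labelled_mat xs f ^\<^sub>m 0) x y = (if x = y then 1 else 0)"
  using assms
  by (auto simp: in_set_conv_nth entry_at_def labelled_mat_def position_nth nth_eq_iff_index_eq)

lemma entry_at_pow_Suc:
  assumes xs: "distinct xs" and x: "x \<in> set xs" and y: "y \<in> set xs"
  shows "entry_at xs (labelled_mat xs f ^\<^sub>m Suc n) x y =
    (\<Sum>z\<in>set xs. f x z * entry_at xs (labelled_mat xs f ^\<^sub>m n) z y)"
proof -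
  let ?A = "labelled_mat xs f"
  obtain i where i: "i < length xs" "x = xs ! i" using x by (auto simp: in_set_conv_nth)
  obtain j where j: "j < length xs" "y = xs ! j" using y by (auto simp: in_set_conv_nth)
  have P: "?A ^\<^sub>m n \<in> carrier_mat (length xs) (length xs)"
    by (intro pow_carrier_mat labelled_mat_carrier)
  have "entry_at xs (?A ^\<^sub>m Suc n) x y = (?A * ?A ^\<^sub>m n) $$ (i, j)"
    using i j xs by (simp add: entry_at_def position_nth pow_mat_Suc_left[OF labelled_mat_carrier]
        del: pow_mat.simps)
  also have "\<dots> = (\<Sum>l<length xs. f x (xs ! l) * (?A ^\<^sub>m n) $$ (l, j))"
    using i j P labelled_mat_carrier[of xs f]
    by (auto simp: scalar_prod_def labelled_mat_def atLeast0LessThan intro!: sum.cong)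
  also have "\<dots> = (\<Sum>l<length xs. f x (xs ! l) * entry_at xs (?A ^\<^sub>m n) (xs ! l) y)"
    using j xs by (intro sum.cong) (auto simp: entry_at_def position_nth)
  also have "\<dots> = (\<Sum>z\<in>set xs. f x z * entry_at xs (?A ^\<^sub>m n) z y)"
    using bij_betw_nth[OF xs refl refl] by (rule sum.reindex_bij_betw)
  finally show ?thesis .
qed

section \<open>Signatures over an arbitrary column graph\<close>

text \<open>An arc \<open>(i, j)\<close> means that \<open>j\<close> dominates \<open>i\<close>, as in \<^const>\<open>dominating_set\<close>; read in this
  direction, the argument holds for digraphs.\<close>

locale column_graph =
  fixes H :: "nat pair_pre_digraph" and m :: nat
  assumes wf: "pair_wf_digraph H"
    and verts: "pverts H = {..<m}"
begin

lemma arc_less: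
  assumes "(i, j) \<in> parcs H"
  shows "i < m \<and> j < m"
proof -
  interpret pair_wf_digraph H by (rule wf)
  show ?thesis using wellformed'[OF assms] verts by auto
qed

text \<open>An uncovered vertex next to an occupied one is a contradiction; the forbidden substrings of the
  linear and of the cyclic signatures both express this.\<close>

definition signature :: "letter list \<Rightarrow> bool" where
  "signature \<sigma> \<longleftrightarrow> length \<sigma> = m \<and>
     (\<forall>(i, j)\<in>parcs H. \<not> (\<sigma> ! i = Uncovered \<and> \<sigma> ! j = Occupied))"

definition col_compatible :: "letter list \<Rightarrow> letter list \<Rightarrow> bool" where
  "col_compatible \<tau> \<sigma> \<longleftrightarrow> (\<forall>i<m.
     (\<sigma> ! i = Uncovered \<longrightarrow> \<tau> ! i = Occupied) \<and>
     (\<sigma> ! i = Occupied \<longrightarrow> \<tau> ! i \<in> {Covered, Occupied}) \<and>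
     (\<tau> ! i = Covered \<longrightarrow>
        \<sigma> ! i = Occupied \<or> (\<exists>j. (i, j) \<in> parcs H \<and> \<tau> ! j = Occupied)))"

definition occupied :: "letter list \<Rightarrow> nat set" where
  "occupied \<tau> = {i. i < m \<and> \<tau> ! i = Occupied}"

definition next_signature :: "nat set \<Rightarrow> letter list \<Rightarrow> letter list" where
  "next_signature X \<sigma> = map (\<lambda>i. if i \<in> X then Occupied
     else if \<sigma> ! i = Occupied \<or> (\<exists>j\<in>X. (i, j) \<in> parcs H) then Covered else Uncovered) [0..<m]"

lemma finite_signatures: "finite {\<sigma>. signature \<sigma>}"
proof (rule finite_subset)
  show "{\<sigma>. signature \<sigma>} \<subseteq> set (List.n_lists m [Uncovered, Covered, Occupied])"
    unfolding set_n_lists letters_eq by (auto simp: signature_def)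
qed simp

lemma length_next_signature [simp]: "length (next_signature X \<sigma>) = m"
  by (simp add: next_signature_def)

lemma next_signature_nth: "i < m \<Longrightarrow> next_signature X \<sigma> ! i = (if i \<in> X then Occupied
     else if \<sigma> ! i = Occupied \<or> (\<exists>j\<in>X. (i, j) \<in> parcs H) then Covered else Uncovered)"
  by (simp add: next_signature_def)

text \<open>Every choice of a column leads to a legal signature, so that no vertex sets are lost by summing
  over signatures only.\<close>

lemma signature_next_signature: "signature (next_signature X \<sigma>)"
proof -
  have "\<not> (next_signature X \<sigma> ! i = Uncovered \<and> next_signature X \<sigma> ! j = Occupied)"
    if "(i, j) \<in> parcs H" for i j
    using that arc_less[OF that] by (auto simp: next_signature_nth split: if_splits)
  then show ?thesis by (auto simp: signature_def)
qed

lemma signature_all_covered: "signature (replicate m Covered)"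
  unfolding signature_def using arc_less by fastforce

lemma occupied_next_signature: "X \<subseteq> {..<m} \<Longrightarrow> occupied (next_signature X \<sigma>) = X"
  by (auto simp: occupied_def next_signature_nth split: if_splits)

text \<open>Being a signature forces \<open>\<tau>\<close> to mark as covered what its own column dominates, compatibility
  forces it to mark as covered what the previous column dominates, and nothing else may be marked.
  Hence the occupied positions and \<open>\<sigma>\<close> determine all other letters.\<close>

lemma col_compatible_iff_next_signature:
  assumes \<tau>: "signature \<tau>"
  shows "col_compatible \<tau> \<sigma> \<longleftrightarrow>
    next_signature (occupied \<tau>) \<sigma> = \<tau> \<and> (\<forall>i<m. \<sigma> ! i = Uncovered \<longrightarrow> i \<in> occupied \<tau>)"
    (is "_ \<longleftrightarrow> ?R")
proof
  assume c: "col_compatible \<tau> \<sigma>"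
  have "next_signature (occupied \<tau>) \<sigma> ! i = \<tau> ! i" if i: "i < m" for i
  proof (cases "\<tau> ! i")
    case Uncovered
    have "\<tau> ! j \<noteq> Occupied" if "(i, j) \<in> parcs H" for j
      using \<tau> that Uncovered by (auto simp: signature_def)
    moreover have "\<sigma> ! i \<noteq> Occupied" using c i Uncovered by (auto simp: col_compatible_def)
    ultimately show ?thesis using i Uncovered by (auto simp: next_signature_nth occupied_def)
  next
    case Covered
    then have "\<sigma> ! i = Occupied \<or> (\<exists>j. (i, j) \<in> parcs H \<and> \<tau> ! j = Occupied)"
      using c i by (auto simp: col_compatible_def)
    then show ?thesis using i Covered arc_less by (auto simp: next_signature_nth occupied_def)
  next
    case Occupied
    then show ?thesis using i by (auto simp: next_signature_nth occupied_def)
  qed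
  then have "next_signature (occupied \<tau>) \<sigma> = \<tau>"
    using \<tau> by (intro nth_equalityI) (auto simp: signature_def)
  with c show ?R by (auto simp: col_compatible_def occupied_def)
next
  assume R: ?R
  then have nth: "\<tau> ! i = (if i \<in> occupied \<tau> then Occupied
     else if \<sigma> ! i = Occupied \<or> (\<exists>j\<in>occupied \<tau>. (i, j) \<in> parcs H) then Covered else Uncovered)"
    if "i < m" for i
    using next_signature_nth[OF that, of "occupied \<tau>" \<sigma>] by simp
  show "col_compatible \<tau> \<sigma>"
    unfolding col_compatible_def
  proof (intro allI impI conjI)
    fix i assume i: "i < m"
    show "\<tau> ! i = Occupied" if "\<sigma> ! i = Uncovered"
      using that R i by (auto simp: occupied_def)
    show "\<tau> ! i \<in> {Covered, Occupied}" if "\<sigma> ! i = Occupied"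
      using that nth[OF i] by auto
    show "\<sigma> ! i = Occupied \<or> (\<exists>j. (i, j) \<in> parcs H \<and> \<tau> ! j = Occupied)" if "\<tau> ! i = Covered"
    proof -
      have "\<sigma> ! i = Occupied \<or> (\<exists>j\<in>occupied \<tau>. (i, j) \<in> parcs H)"
        using that unfolding nth[OF i] by (simp split: if_splits)
      then show ?thesis by (auto simp: occupied_def)
    qed
  qed
qed

section \<open>Reading a vertex set column by column\<close>

text \<open>Word \<open>k\<close> describes the column with index \<open>k - 1\<close>. The word for \<open>0\<close> is the imaginary covered
  column in front of the graph.\<close>

primrec column_signature :: "(nat \<times> nat) set \<Rightarrow> nat \<Rightarrow> letter list" where
  "column_signature S 0 = replicate m Covered"
| "column_signature S (Suc k) = next_signature {i. (i, k) \<in> S} (column_signature S k)"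

text \<open>All columns except the last are dominated. The condition on \<open>k\<close> concerns the vertices of
  column \<open>k - 1\<close>, whose last hope is column \<open>k\<close>.\<close>

definition pre_dominating :: "nat \<Rightarrow> (nat \<times> nat) set \<Rightarrow> bool" where
  "pre_dominating n S \<longleftrightarrow> S \<subseteq> {..<m} \<times> {..<n} \<and>
     (\<forall>k<n. \<forall>i<m. column_signature S k ! i = Uncovered \<longrightarrow> (i, k) \<in> S)"

lemma length_column_signature [simp]: "length (column_signature S k) = m"
  by (cases k) auto

lemma signature_column_signature: "signature (column_signature S k)"
proof (cases k)
  case 0
  then show ?thesis by (simp add: signature_all_covered)
next
  case (Suc l)
  then show ?thesis by (simp add: signature_next_signature)
qed

text \<open>A word depends only on the columns already read, so that appending a column leaves the earlier
  words unchanged.\<close>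

lemma column_signature_cong:
  assumes "\<And>i l. l < k \<Longrightarrow> (i, l) \<in> S \<longleftrightarrow> (i, l) \<in> T"
  shows "column_signature S k = column_signature T k"
  using assms by (induction k) auto

lemma column_signature_nth_eq_Occupied:
  "i < m \<Longrightarrow> column_signature S k ! i = Occupied \<longleftrightarrow> (\<exists>l. k = Suc l \<and> (i, l) \<in> S)"
  by (cases k) (auto simp: next_signature_nth)

text \<open>The recursively computed letters have the intended meaning: an uncovered vertex is one that
  neither itself, nor its predecessor in the row, nor a neighbour in its column lies in the set.\<close>

lemma column_signature_Suc_nth_eq_Uncovered:
  assumes "i < m"
  shows "column_signature S (Suc k) ! i = Uncovered \<longleftrightarrow>
    (i, k) \<notin> S \<and> (\<forall>l. k = Suc l \<longrightarrow> (i, l) \<notin> S) \<and> (\<forall>j. (i, j) \<in> parcs H \<longrightarrow> (j, k) \<notin> S)"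
  using assms by (auto simp: next_signature_nth column_signature_nth_eq_Occupied)

text \<open>A vertex in column \<open>k\<close> is dominated either from the columns up to \<open>k\<close>, and then it is not
  uncovered in word \<open>k + 1\<close>, or from column \<open>k + 1\<close>. In the last column only the first
  alternative remains.\<close>

lemma dominating_set_iff:
  "dominating_set (cartesian_product H (path_graph n)) S \<longleftrightarrow>
     pre_dominating n S \<and> Uncovered \<notin> set (column_signature S n)"
    (is "?D \<longleftrightarrow> ?P \<and> ?U")
proof (cases "S \<subseteq> {..<m} \<times> {..<n}")
  case False
  then show ?thesis
    by (auto simp: dominating_set_def pre_dominating_def cartesian_product_def path_graph_def verts)
next
  case sub: True
  have "?D \<longleftrightarrow> (\<forall>k<n. \<forall>i<m. column_signature S (Suc k) ! i = Uncovered \<longrightarrow> (i, Suc k) \<in> S)"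
  proof -
    have "((i, k) \<in> S \<or> (\<exists>w\<in>S. ((i, k), w) \<in> parcs (cartesian_product H (path_graph n))))
      \<longleftrightarrow> (column_signature S (Suc k) ! i = Uncovered \<longrightarrow> (i, Suc k) \<in> S)"
      (is "?L \<longleftrightarrow> ?R") if "k < n" "i < m" for i k
    proof -
      have "((i, k), (j, l)) \<in> parcs (cartesian_product H (path_graph n)) \<longleftrightarrow>
        i = j \<and> (l = Suc k \<or> k = Suc l) \<or> l = k \<and> (i, j) \<in> parcs H" if "(j, l) \<in> S" for j l
        using sub that \<open>k < n\<close> \<open>i < m\<close>
        by (auto simp: cartesian_product_def path_graph_def verts)
      then show ?thesis
        unfolding column_signature_Suc_nth_eq_Uncovered[OF \<open>i < m\<close>] by fast
    qed
    then show ?thesis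
      using sub by (auto simp: dominating_set_def cartesian_product_def path_graph_def verts)
  qed
  \<comment> \<open>Word \<open>0\<close> has no uncovered letter, so the index can be shifted.\<close>
  also have "\<dots> \<longleftrightarrow> (\<forall>k\<le>n. \<forall>i<m. column_signature S k ! i = Uncovered \<longrightarrow> (i, k) \<in> S)"
    (is "?A \<longleftrightarrow> ?B")
  proof
    assume A: ?A
    show ?B
    proof (intro allI impI)
      fix k i assume "k \<le> n" "i < m" "column_signature S k ! i = Uncovered"
      then show "(i, k) \<in> S" using A by (cases k) auto
    qed
  next
    assume ?B
    then show ?A by (metis Suc_leI)
  qed
  also have "\<dots> \<longleftrightarrow> ?P \<and> ?U"
  proof -
    have "(i, n) \<notin> S" for i using sub by auto
    then show ?thesis
      using sub by (auto simp: pre_dominating_def in_set_conv_nth le_less)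
  qed
  finally show ?thesis .
qed

lemma finite_pre_dominating: "finite {S. pre_dominating n S \<and> Q S}"
  by (rule finite_subset[of _ "Pow ({..<m} \<times> {..<n})"]) (auto simp: pre_dominating_def)

lemma pre_dominating_0: "pre_dominating 0 S \<longleftrightarrow> S = {}"
  by (auto simp: pre_dominating_def)

lemma pre_dominating_Suc_iff:
  assumes S: "S \<subseteq> {..<m} \<times> {..<n}" and X: "X \<subseteq> {..<m}"
  shows "pre_dominating (Suc n) (S \<union> X \<times> {n}) \<longleftrightarrow>
      pre_dominating n S \<and> (\<forall>i<m. column_signature S n ! i = Uncovered \<longrightarrow> i \<in> X)"
    and "column_signature (S \<union> X \<times> {n}) (Suc n) = next_signature X (column_signature S n)"
proof -
  have eq: "column_signature (S \<union> X \<times> {n}) k = column_signature S k" if "k \<le> n" for k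
    using that by (intro column_signature_cong) auto
  have n: "(i, n) \<notin> S" for i using S by auto
  have "{i. (i, n) \<in> S \<union> X \<times> {n}} = X" using n by auto
  then show "column_signature (S \<union> X \<times> {n}) (Suc n) = next_signature X (column_signature S n)"
    by (simp add: eq)
  have "S \<union> X \<times> {n} \<subseteq> {..<m} \<times> {..<Suc n}" using S X by (auto simp: less_Suc_eq)
  then show "pre_dominating (Suc n) (S \<union> X \<times> {n}) \<longleftrightarrow>
      pre_dominating n S \<and> (\<forall>i<m. column_signature S n ! i = Uncovered \<longrightarrow> i \<in> X)"
    using S n eq by (auto simp: pre_dominating_def less_Suc_eq)
qed

text \<open>The polynomial that the entry \<open>(\<sigma>, \<sigma>\<^sub>c)\<close> of the \<open>n\<close>-th power of the transfer matrix will turn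
  out to be.\<close>

definition restricted_poly :: "nat \<Rightarrow> letter list \<Rightarrow> int poly" where
  "restricted_poly n \<sigma> =
     (\<Sum>S | pre_dominating n S \<and> column_signature S n = \<sigma>. monom 1 (card S))"

definition transfer_weight :: "letter list \<Rightarrow> letter list \<Rightarrow> int poly" where
  "transfer_weight \<tau> \<sigma> = (if col_compatible \<tau> \<sigma> then monom 1 (count_list \<tau> Occupied) else 0)"

lemma card_occupied: "length \<tau> = m \<Longrightarrow> card (occupied \<tau>) = count_list \<tau> Occupied"
  unfolding occupied_def count_list_eq_length_filter length_filter_conv_card by metis

lemma sum_by_column_signature:
  fixes g :: "(nat \<times> nat) set \<Rightarrow> 'b :: comm_monoid_add"
  shows "(\<Sum>\<sigma> | signature \<sigma> \<and> Q \<sigma>. \<Sum>S | pre_dominating n S \<and> column_signature S n = \<sigma>. g S) =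
    (\<Sum>S | pre_dominating n S \<and> Q (column_signature S n). g S)"
proof -
  have fin: "finite {\<sigma>. signature \<sigma> \<and> Q \<sigma>}"
    by (rule finite_subset[OF _ finite_signatures]) auto
  have "(\<Sum>S | pre_dominating n S \<and> Q (column_signature S n). g S) =
    (\<Sum>\<sigma> | signature \<sigma> \<and> Q \<sigma>. \<Sum>S | S \<in> {S. pre_dominating n S \<and> Q (column_signature S n)} \<and>
       column_signature S n = \<sigma>. g S)"
    by (rule sum.group[symmetric, OF finite_pre_dominating fin])
       (auto simp: signature_column_signature)
  also have "\<dots> = (\<Sum>\<sigma> | signature \<sigma> \<and> Q \<sigma>.
      \<Sum>S | pre_dominating n S \<and> column_signature S n = \<sigma>. g S)"
    by (intro sum.cong) auto
  finally show ?thesis ..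
qed

lemma restricted_poly_0:
  "restricted_poly 0 \<sigma> = (if \<sigma> = replicate m Covered then 1 else 0)"
proof -
  have "{S. pre_dominating 0 S \<and> column_signature S 0 = \<sigma>} =
      (if \<sigma> = replicate m Covered then {{}} else {})"
    by (auto simp: pre_dominating_0)
  then show ?thesis by (simp add: restricted_poly_def)
qed

text \<open>Removing the last column is a bijection from the sets that end in \<open>\<tau>\<close> to the sets that end in
  a signature with which \<open>\<tau>\<close> is compatible; it lowers the size by the number of occupied
  positions of \<open>\<tau>\<close>.\<close>

lemma restricted_poly_Suc:
  assumes \<tau>: "signature \<tau>"
  shows "restricted_poly (Suc n) \<tau> = (\<Sum>\<sigma> | signature \<sigma>. transfer_weight \<tau> \<sigma> * restricted_poly n \<sigma>)"
proof -
  let ?X = "occupied \<tau>"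
  have X: "?X \<subseteq> {..<m}" by (auto simp: occupied_def)
  have ext: "pre_dominating (Suc n) (S \<union> ?X \<times> {n}) \<and> column_signature (S \<union> ?X \<times> {n}) (Suc n) = \<tau>
      \<longleftrightarrow> pre_dominating n S \<and> col_compatible \<tau> (column_signature S n)"
    if "S \<subseteq> {..<m} \<times> {..<n}" for S
    unfolding pre_dominating_Suc_iff[OF that X] col_compatible_iff_next_signature[OF \<tau>] by blast
  have "(\<Sum>\<sigma> | signature \<sigma>. transfer_weight \<tau> \<sigma> * restricted_poly n \<sigma>) =
    (\<Sum>\<sigma> | signature \<sigma> \<and> col_compatible \<tau> \<sigma>. transfer_weight \<tau> \<sigma> * restricted_poly n \<sigma>)"
    by (intro sum.mono_neutral_right finite_signatures) (auto simp: transfer_weight_def)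
  also have "\<dots> = (\<Sum>\<sigma> | signature \<sigma> \<and> col_compatible \<tau> \<sigma>.
      \<Sum>S | pre_dominating n S \<and> column_signature S n = \<sigma>. monom 1 (card ?X) * monom 1 (card S))"
    using \<tau> by (intro sum.cong)
      (auto simp: transfer_weight_def restricted_poly_def sum_distrib_left card_occupied signature_def)
  also have "\<dots> = (\<Sum>S | pre_dominating n S \<and> col_compatible \<tau> (column_signature S n).
      monom 1 (card ?X) * monom 1 (card S))"
    by (rule sum_by_column_signature)
  also have "\<dots> = (\<Sum>S | pre_dominating (Suc n) S \<and> column_signature S (Suc n) = \<tau>. monom 1 (card S))"
  proof (rule sum.reindex_bij_witness[where j = "\<lambda>S. S \<union> ?X \<times> {n}" and i = "\<lambda>S. S \<inter> UNIV \<times> {..<n}"])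
    fix S assume S: "S \<in> {S. pre_dominating n S \<and> col_compatible \<tau> (column_signature S n)}"
    then have sub: "S \<subseteq> {..<m} \<times> {..<n}" by (auto simp: pre_dominating_def)
    show "(S \<union> ?X \<times> {n}) \<inter> UNIV \<times> {..<n} = S" using sub by auto
    show "S \<union> ?X \<times> {n} \<in> {S. pre_dominating (Suc n) S \<and> column_signature S (Suc n) = \<tau>}"
      using S ext[OF sub] by blast
    have "card (S \<union> ?X \<times> {n}) = card S + card (?X \<times> {n})"
      using finite_subset[OF sub] finite_subset[OF X] sub by (subst card_Un_disjoint) auto
    then show "monom 1 (card (S \<union> ?X \<times> {n})) = monom 1 (card ?X) * (monom 1 (card S) :: int poly)"
      by (simp add: card_cartesian_product mult_monom add.commute)
  next
    fix S assume S: "S \<in> {S. pre_dominating (Suc n) S \<and> column_signature S (Suc n) = \<tau>}"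
    then have sub: "S \<subseteq> {..<m} \<times> {..<Suc n}" by (auto simp: pre_dominating_def)
    \<comment> \<open>The prescribed signature determines the last column.\<close>
    have "{i. (i, n) \<in> S} \<subseteq> {..<m}" using sub by auto
    moreover have "next_signature {i. (i, n) \<in> S} (column_signature S n) = \<tau>" using S by simp
    ultimately have last: "?X = {i. (i, n) \<in> S}"
      using occupied_next_signature by metis
    show eq: "S \<inter> UNIV \<times> {..<n} \<union> ?X \<times> {n} = S"
      unfolding last using sub by (auto simp: less_Suc_eq)
    have "S \<inter> UNIV \<times> {..<n} \<subseteq> {..<m} \<times> {..<n}" using sub by auto
    from ext[OF this] S
    show "S \<inter> UNIV \<times> {..<n} \<in> {S. pre_dominating n S \<and> col_compatible \<tau> (column_signature S n)}"
      unfolding eq by blast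
  qed
  finally show ?thesis by (simp add: restricted_poly_def)
qed

section \<open>Domination polynomials from powers of the transfer matrix\<close>

text \<open>Both sides start from the fully covered column and obey the same recursion.\<close>

lemma entry_at_pow_transfer:
  assumes xs: "distinct xs" "set xs = {\<sigma>. signature \<sigma>}" and \<tau>: "signature \<tau>"
  shows "entry_at xs (labelled_mat xs transfer_weight ^\<^sub>m n) \<tau> (replicate m Covered) = restricted_poly n \<tau>"
  using \<tau>
proof (induction n arbitrary: \<tau>)
  case 0
  then have "\<tau> \<in> set xs" by (simp add: xs(2))
  moreover have "replicate m Covered \<in> set xs"
    unfolding xs(2) using signature_all_covered by (rule CollectI)
  ultimately show ?case
    unfolding restricted_poly_0 by (rule entry_at_pow_0[OF xs(1)])
next
  case (Suc n)
  have c: "replicate m Covered \<in> set xs"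
    unfolding xs(2) using signature_all_covered by (rule CollectI)
  have t: "\<tau> \<in> set xs"
    unfolding xs(2) using Suc.prems by (rule CollectI)
  have "entry_at xs (labelled_mat xs transfer_weight ^\<^sub>m Suc n) \<tau> (replicate m Covered) =
    (\<Sum>\<sigma> | signature \<sigma>. transfer_weight \<tau> \<sigma> *
      entry_at xs (labelled_mat xs transfer_weight ^\<^sub>m n) \<sigma> (replicate m Covered))"
    by (rule entry_at_pow_Suc[OF xs(1) t c, unfolded xs(2)])
  also have "\<dots> = (\<Sum>\<sigma> | signature \<sigma>. transfer_weight \<tau> \<sigma> * restricted_poly n \<sigma>)"
    by (intro sum.cong) (simp_all add: Suc.IH)
  finally show ?case using restricted_poly_Suc[OF Suc.prems] by (rule trans[OF _ sym])
qed

text \<open>The signatures may be listed in any order, since matrix entries are addressed by label.\<close>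

theorem domination_poly_cartesian_path:
  assumes "distinct xs" "set xs = {\<sigma>. signature \<sigma>}"
  shows "domination_poly (cartesian_product H (path_graph n)) =
    (\<Sum>\<sigma> | signature \<sigma> \<and> count_list \<sigma> Uncovered = 0.
      entry_at xs (labelled_mat xs transfer_weight ^\<^sub>m n) \<sigma> (replicate m Covered))"
proof -
  have "(\<Sum>\<sigma> | signature \<sigma> \<and> count_list \<sigma> Uncovered = 0.
      entry_at xs (labelled_mat xs transfer_weight ^\<^sub>m n) \<sigma> (replicate m Covered)) =
    (\<Sum>\<sigma> | signature \<sigma> \<and> Uncovered \<notin> set \<sigma>. restricted_poly n \<sigma>)"
    unfolding count_list_0_iff
    by (rule sum.cong[OF refl]) (simp only: mem_Collect_eq entry_at_pow_transfer[OF assms])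
  also have "\<dots> = domination_poly (cartesian_product H (path_graph n))"
    unfolding restricted_poly_def domination_poly_def dominating_set_iff
    by (rule sum_by_column_signature)
  finally show ?thesis ..
qed

end

section \<open>Paths and cycles as column graphs\<close>

lemma column_graph_path: "column_graph (path_graph m) m"
proof -
  interpret pair_graph "path_graph m" by (rule pair_graph_path_graph)
  show ?thesis by unfold_locales (simp add: path_graph_def)
qed

lemma column_graph_cycle: "column_graph (cycle_graph m) m"
proof -
  interpret pair_graph "cycle_graph m" by (rule pair_graph_cycle_graph)
  show ?thesis by unfold_locales (simp add: cycle_graph_def)
qed

lemma path_signature: "column_graph.signature (path_graph m) m = is_signature m"
proof
  fix \<sigma>
  show "column_graph.signature (path_graph m) m \<sigma> = is_signature m \<sigma>"
    unfolding column_graph.signature_def[OF column_graph_path] is_signature_def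
    by (auto simp: path_graph_def) (use Suc_lessD in blast)+
qed

lemma path_compatible: "column_graph.col_compatible (path_graph m) m = compatible m"
proof (intro ext)
  fix \<tau> \<sigma>
  have "(\<exists>j. (i, j) \<in> parcs (path_graph m) \<and> \<tau> ! j = Occupied) \<longleftrightarrow>
      (0 < i \<and> \<tau> ! (i - 1) = Occupied) \<or> (i + 1 < m \<and> \<tau> ! (i + 1) = Occupied)" if "i < m" for i
    using that by (cases i) (auto simp: path_graph_def intro: Suc_lessD)
  then show "column_graph.col_compatible (path_graph m) m \<tau> \<sigma> = compatible m \<tau> \<sigma>"
    unfolding column_graph.col_compatible_def[OF column_graph_path] compatible_def by auto
qed

text \<open>A cycle is a path with one additional edge, just as a cyclic signature is a signature with one
  additional condition. For \<open>m = 1\<close> the additional edge would be a loop; for \<open>m = 2\<close> it coincides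
  with the edge of the path.\<close>

lemma cycle_arcs:
  assumes "1 \<le> m"
  shows "parcs (cycle_graph m) = parcs (path_graph m) \<union>
    (if m = 1 then {} else {(0, m - 1), (m - 1, 0)})"
proof (rule Set.set_eqI)
  fix p :: "nat \<times> nat"
  obtain i j where p: "p = (i, j)" by (cases p)
  have s: "(i + 1) mod m = (if i + 1 = m then 0 else i + 1)" if "i < m" using that by auto
  have t: "(i + m - 1) mod m = (if i = 0 then m - 1 else i - 1)" if "i < m"
    using that by (cases i) auto
  show "p \<in> parcs (cycle_graph m) \<longleftrightarrow> p \<in> parcs (path_graph m) \<union>
    (if m = 1 then {} else {(0, m - 1), (m - 1, 0)})"
  proof (cases "i < m \<and> j < m")
    case True
    then show ?thesis
      unfolding p using s t by (auto simp: cycle_graph_def path_graph_def split: if_splits)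
  next
    case False
    then show ?thesis
      unfolding p using assms by (auto simp: cycle_graph_def path_graph_def split: if_splits)
  qed
qed

lemma cycle_signature:
  assumes "1 \<le> m"
  shows "column_graph.signature (cycle_graph m) m = is_cyclic_signature m"
proof
  fix \<sigma>
  have "column_graph.signature (cycle_graph m) m \<sigma> \<longleftrightarrow>
    column_graph.signature (path_graph m) m \<sigma> \<and> {\<sigma> ! 0, \<sigma> ! (m - 1)} \<noteq> {Uncovered, Occupied}"
    unfolding column_graph.signature_def[OF column_graph_path]
      column_graph.signature_def[OF column_graph_cycle] cycle_arcs[OF assms]
    by (auto simp: doubleton_eq_iff)
  then show "column_graph.signature (cycle_graph m) m \<sigma> = is_cyclic_signature m \<sigma>"
    by (simp add: path_signature is_cyclic_signature_def)
qed

lemma cycle_compatible: "column_graph.col_compatible (cycle_graph m) m = cyclic_compatible m"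
proof (intro ext)
  fix \<tau> \<sigma>
  \<comment> \<open>For \<open>m = 1\<close> the index arithmetic returns \<open>i\<close> itself, which is not its own neighbour in the
    cycle. No harm is done, because a covered position is not occupied.\<close>
  have "(\<exists>j. (i, j) \<in> parcs (cycle_graph m) \<and> \<tau> ! j = Occupied) \<longleftrightarrow>
      \<tau> ! ((i + m - 1) mod m) = Occupied \<or> \<tau> ! ((i + 1) mod m) = Occupied"
    if "i < m" and "\<tau> ! i = Covered" for i
  proof -
    have "(i + m - 1) mod m < m" "(i + 1) mod m < m" using that by simp_all
    then have "(i, j) \<in> parcs (cycle_graph m) \<longleftrightarrow>
        i \<noteq> j \<and> (j = (i + 1) mod m \<or> j = (i + m - 1) mod m)" for j
      using \<open>i < m\<close> unfolding cycle_graph_def by auto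
    then show ?thesis using \<open>\<tau> ! i = Covered\<close> by (metis letter.distinct)
  qed
  then show "column_graph.col_compatible (cycle_graph m) m \<tau> \<sigma> = cyclic_compatible m \<tau> \<sigma>"
    unfolding column_graph.col_compatible_def[OF column_graph_cycle] cyclic_compatible_def by auto
qed

lemma path_transfer_weight:
  "column_graph.transfer_weight (path_graph m) m =
    (\<lambda>\<tau> \<sigma>. if compatible m \<tau> \<sigma> then monom 1 (count_list \<tau> Occupied) else 0)"
  by (intro ext) (simp add: column_graph.transfer_weight_def[OF column_graph_path] path_compatible)

lemma cycle_transfer_weight:
  "column_graph.transfer_weight (cycle_graph m) m =
    (\<lambda>\<tau> \<sigma>. if cyclic_compatible m \<tau> \<sigma> then monom 1 (count_list \<tau> Occupied) else 0)"
  by (intro ext) (simp add: column_graph.transfer_weight_def[OF column_graph_cycle] cycle_compatible)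

theorem theorem7:
  fixes m n :: nat
  assumes "m \<ge> 1" and "n \<ge> 1"
  shows "domination_poly (grid_graph m n) =
           (\<Sum>\<sigma> | is_signature m \<sigma> \<and> count_list \<sigma> Uncovered = 0.
              entry_at (signatures m) (transfer_matrix m ^\<^sub>m n) \<sigma> (replicate m Covered))
       \<and> domination_poly (cylinder_graph m n) =
           (\<Sum>\<sigma> | is_cyclic_signature m \<sigma> \<and> count_list \<sigma> Uncovered = 0.
              entry_at (cyclic_signatures m) (cyclic_transfer_matrix m ^\<^sub>m n) \<sigma> (replicate m Covered))"
proof
  have "transfer_matrix m = labelled_mat (signatures m) (column_graph.transfer_weight (path_graph m) m)"
    unfolding transfer_matrix_def path_transfer_weight ..
  then show "domination_poly (grid_graph m n) =
           (\<Sum>\<sigma> | is_signature m \<sigma> \<and> count_list \<sigma> Uncovered = 0.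
              entry_at (signatures m) (transfer_matrix m ^\<^sub>m n) \<sigma> (replicate m Covered))"
    using column_graph.domination_poly_cartesian_path[OF column_graph_path distinct_signatures]
    by (simp add: grid_graph_def path_signature set_signatures)
  have "cyclic_transfer_matrix m =
      labelled_mat (cyclic_signatures m) (column_graph.transfer_weight (cycle_graph m) m)"
    unfolding cyclic_transfer_matrix_def cycle_transfer_weight ..
  then show "domination_poly (cylinder_graph m n) =
           (\<Sum>\<sigma> | is_cyclic_signature m \<sigma> \<and> count_list \<sigma> Uncovered = 0.
              entry_at (cyclic_signatures m) (cyclic_transfer_matrix m ^\<^sub>m n) \<sigma> (replicate m Covered))"
    using column_graph.domination_poly_cartesian_path[OF column_graph_cycle distinct_cyclic_signatures]
    by (simp add: cylinder_graph_def cycle_signature[OF assms(1)] set_cyclic_signatures)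
qed

end
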